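(* Let $\mathrm{BT}_{24}$ be the binary tetrahedral group and let $G=\mathcal{C}(\mathrm{BT}_{24},\Gamma)$ be a commuting graph on $\mathrm{BT}_{24}$. Then, up to isomorphism, $$G=\begin{cases}K_2 & \text{when }\Gamma=\mathcal{B}_i\text{ for } i=1,\ldots,4,\\ K_4 & \text{when }\Gamma=\mathcal{C}_i\text{ for } i=1,\ldots,4,\\ K_2\vee(3K_2\cup 4K_4) & \text{when }\Gamma=\mathrm{BT}_{24}.\end{cases}$$
   Context: The binary tetrahedral group of order 24 is presented as $\mathrm{BT}_{24}=\langle r,s,t\mid r^2=s^3=t^3=rst\rangle$. Consider the following subsets of $\mathrm{BT}_{24}$: $\mathcal{B}_1=Z(\mathrm{BT}_{24})=\{1,r^2\}$ (the center), $\mathcal{B}_2=\{r,r^{-1}\}$, $\mathcal{B}_3=\{ts,s^{-1}t^{-1}\}$, $\mathcal{B}_4=\{tsr,s^{-1}t^{-1}r\}$; $\mathcal{C}_1=\{s,s^{-1},s^{-2},tr\}$, $\mathcal{C}_2=\{rt,r^{-1}t,t^{-1}r^{-1},t^{-1}r\}$, $\mathcal{C}_3=\{t,t^{-1},rs,s^{-1}r^{-1}\}$, $\mathcal{C}_4=\{sr,t^{-1}s,s^{-1}t,r^{-1}s^{-1}\}$. For a group $H$ and a nonempty subset $\Gamma\subseteq H$, $\mathcal{C}(H,\Gamma)$ is the simple graph with node set $\Gamma$ in which two distinct elements are joined by an edge if and only if they commute in $H$. $K_m$ is the complete graph on $m$ nodes, $rK_m$ (for an integer $r$) is the graph consisting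 of $r$ (disjoint) copies of $K_m$, $\cup$ denotes disjoint union of graphs, and the join $G_1\vee G_2$ is the graph with node set $V(G_1)\cup V(G_2)$ and edge set $E(G_1)\cup E(G_2)\cup\{y\sim z: y\in V(G_1),z\in V(G_2)\}$. *)

theory Defs
  imports "HOL-Algebra.Group" "Graph_Theory.Graph_Theory"
begin

section \<open>Groups given by generators and relations\<close>

text \<open>
  A word over the generators of type \<open>'a\<close> is a list of signed letters; \<open>(x, True)\<close> stands
  for the generator \<open>x\<close> and \<open>(x, False)\<close> for its formal inverse. A set \<open>R\<close> of pairs of
  words is read as a set of defining relations \<open>u = v\<close>.
\<close>

type_synonym 'a word = "('a \<times> bool) list"

inductive pres_eq :: "('a word \<times> 'a word) set \<Rightarrow> 'a word \<Rightarrow> 'a word \<Rightarrow> bool"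
  for R where
  relation: "(u, v) \<in> R \<Longrightarrow> pres_eq R u v"
| cancel: "pres_eq R [(x, e), (x, \<not> e)] []"
| refl: "pres_eq R u u"
| sym: "pres_eq R u v \<Longrightarrow> pres_eq R v u"
| trans: "pres_eq R u v \<Longrightarrow> pres_eq R v w \<Longrightarrow> pres_eq R u w"
| append: "pres_eq R u u' \<Longrightarrow> pres_eq R v v' \<Longrightarrow> pres_eq R (u @ v) (u' @ v')"

definition word_class :: "('a word \<times> 'a word) set \<Rightarrow> 'a word \<Rightarrow> 'a word set" where
  "word_class R u = {v. pres_eq R u v}"

definition presented_group :: "('a word \<times> 'a word) set \<Rightarrow> 'a word set monoid" where
  "presented_group R =
    \<lparr>carrier = range (word_class R),
     monoid.mult = (\<lambda>A B. \<Union>u\<in>A. \<Union>v\<in>B. word_class R (u @ v)),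
     monoid.one = word_class R []\<rparr>"

definition pres_gen :: "('a word \<times> 'a word) set \<Rightarrow> 'a \<Rightarrow> 'a word set" where
  "pres_gen R x = word_class R [(x, True)]"

lemma word_class_eq_iff: "word_class R u = word_class R v \<longleftrightarrow> pres_eq R u v"
proof
  assume "word_class R u = word_class R v"
  moreover have "v \<in> word_class R v"
    by (simp add: word_class_def pres_eq.refl)
  ultimately have "v \<in> word_class R u"
    by simp
  then show "pres_eq R u v"
    by (simp add: word_class_def)
next
  assume uv: "pres_eq R u v"
  show "word_class R u = word_class R v"
    unfolding word_class_def
    using pres_eq.trans[OF uv] pres_eq.trans[OF pres_eq.sym[OF uv]] by blast
qed

lemma mult_word_class:
  "word_class R u \<otimes>\<^bsub>presented_group R\<^esub> word_class R v = word_class R (u @ v)"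
proof -
  have eq: "word_class R (a @ b) = word_class R (u @ v)"
    if "a \<in> word_class R u" "b \<in> word_class R v" for a b
    unfolding word_class_eq_iff using that
    by (intro pres_eq.sym[OF pres_eq.append]) (simp_all add: word_class_def)
  have "u \<in> word_class R u" "v \<in> word_class R v"
    by (simp_all add: word_class_def pres_eq.refl)
  then have "(\<Union>a\<in>word_class R u. \<Union>b\<in>word_class R v. word_class R (a @ b)) = word_class R (u @ v)"
    using eq by blast
  then show ?thesis
    by (simp add: presented_group_def)
qed

definition inv_word :: "'a word \<Rightarrow> 'a word" where
  "inv_word u = rev (map (\<lambda>(x, e). (x, \<not> e)) u)"

lemma inv_word_cancel: "pres_eq R (inv_word u @ u) []"
proof (induction u)
  case Nil
  show ?case by (simp add: inv_word_def pres_eq.refl)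
next
  case (Cons a u)
  obtain x e where a: "a = (x, e)" by (cases a)
  have "pres_eq R [(x, \<not> e), (x, e)] []"
    using pres_eq.cancel[of R x "\<not> e"] by simp
  then have "pres_eq R ([(x, \<not> e), (x, e)] @ u) ([] @ u)"
    by (rule pres_eq.append[OF _ pres_eq.refl])
  then have "pres_eq R (inv_word u @ [(x, \<not> e), (x, e)] @ u) (inv_word u @ [] @ u)"
    by (rule pres_eq.append[OF pres_eq.refl])
  then have "pres_eq R (inv_word (a # u) @ a # u) (inv_word u @ u)"
    by (simp add: inv_word_def a)
  then show ?case
    using Cons.IH by (rule pres_eq.trans)
qed

lemma group_presented_group: "group (presented_group R)"
proof (rule groupI)
  fix A assume "A \<in> carrier (presented_group R)"
  then obtain u where u: "A = word_class R u" by (auto simp: presented_group_def)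
  show "\<one>\<^bsub>presented_group R\<^esub> \<otimes>\<^bsub>presented_group R\<^esub> A = A"
    using mult_word_class[of R "[]" u] by (simp add: presented_group_def u)
  have "word_class R (inv_word u) \<otimes>\<^bsub>presented_group R\<^esub> A = \<one>\<^bsub>presented_group R\<^esub>"
    unfolding u mult_word_class
    by (simp add: presented_group_def word_class_eq_iff inv_word_cancel)
  then show "\<exists>B\<in>carrier (presented_group R). B \<otimes>\<^bsub>presented_group R\<^esub> A = \<one>\<^bsub>presented_group R\<^esub>"
    by (auto simp: presented_group_def)
next
  fix A B C
  assume "A \<in> carrier (presented_group R)" "B \<in> carrier (presented_group R)"
    "C \<in> carrier (presented_group R)"
  then obtain u v w where "A = word_class R u" "B = word_class R v" "C = word_class R w"
    by (auto simp: presented_group_def)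
  then show "A \<otimes>\<^bsub>presented_group R\<^esub> B \<otimes>\<^bsub>presented_group R\<^esub> C =
      A \<otimes>\<^bsub>presented_group R\<^esub> (B \<otimes>\<^bsub>presented_group R\<^esub> C)"
    by (simp add: mult_word_class)
next
  fix A B
  assume "A \<in> carrier (presented_group R)" "B \<in> carrier (presented_group R)"
  then obtain u v where "A = word_class R u" "B = word_class R v"
    by (auto simp: presented_group_def)
  then show "A \<otimes>\<^bsub>presented_group R\<^esub> B \<in> carrier (presented_group R)"
    by (simp add: mult_word_class) (simp add: presented_group_def)
qed (simp add: presented_group_def)

fun word_value :: "('b, 'm) monoid_scheme \<Rightarrow> ('a \<Rightarrow> 'b) \<Rightarrow> 'a word \<Rightarrow> 'b" where
  "word_value H f [] = \<one>\<^bsub>H\<^esub>"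
| "word_value H f ((x, e) # u) = (if e then f x else inv\<^bsub>H\<^esub> f x) \<otimes>\<^bsub>H\<^esub> word_value H f u"

text \<open>The universal property (von Dyck's theorem), existence part.\<close>

lemma presented_group_hom:
  assumes H: "group H" and f: "\<And>x. f x \<in> carrier H"
    and R: "\<And>u v. (u, v) \<in> R \<Longrightarrow> word_value H f u = word_value H f v"
  obtains h where "h \<in> hom (presented_group R) H" "\<And>x. h (pres_gen R x) = f x"
proof -
  interpret group H by (rule H)
  have closed [simp]: "word_value H f u \<in> carrier H" for u
  proof (induction u)
    case (Cons a u)
    then show ?case by (cases a) (simp add: f)
  qed simp
  have app: "word_value H f (u @ v) = word_value H f u \<otimes>\<^bsub>H\<^esub> word_value H f v" for u v
  proof (induction u)
    case (Cons a u)
    then show ?case by (cases a) (simp add: f m_assoc)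
  qed simp
  have eq: "word_value H f u = word_value H f v" if "pres_eq R u v" for u v
    using that
  proof induction
    case (cancel x e)
    show ?case by (simp add: f)
  qed (simp_all add: R app)
  define h where "h A = word_value H f (SOME u. A = word_class R u)" for A
  have h: "h (word_class R u) = word_value H f u" for u
  proof -
    have "word_class R u = word_class R (SOME v. word_class R u = word_class R v)"
      by (rule someI) (rule HOL.refl)
    then show ?thesis
      unfolding h_def word_class_eq_iff by (rule eq[symmetric])
  qed
  have "h \<in> hom (presented_group R) H"
  proof (rule homI)
    fix A B
    assume "A \<in> carrier (presented_group R)" "B \<in> carrier (presented_group R)"
    then obtain u v where "A = word_class R u" "B = word_class R v"
      by (auto simp: presented_group_def)
    then show "h (A \<otimes>\<^bsub>presented_group R\<^esub> B) = h A \<otimes>\<^bsub>H\<^esub> h B"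
      by (simp only: mult_word_class h app)
  qed (auto simp: presented_group_def h)
  moreover have "h (pres_gen R x) = f x" for x
    by (simp add: pres_gen_def h f)
  ultimately show ?thesis by (rule that)
qed

definition group_center :: "('a, 'm) monoid_scheme \<Rightarrow> 'a set" where
  "group_center G = {z \<in> carrier G. \<forall>x\<in>carrier G. z \<otimes>\<^bsub>G\<^esub> x = x \<otimes>\<^bsub>G\<^esub> z}"

section \<open>The binary tetrahedral group\<close>

datatype bt_letter = LR | LS | LT

definition bt_relations :: "(bt_letter word \<times> bt_letter word) set" where
  "bt_relations =
    (let r = (LR, True); s = (LS, True); t = (LT, True)
     in {([r, r], [s, s, s]), ([s, s, s], [t, t, t]), ([t, t, t], [r, s, t])})"

definition BT24 :: "bt_letter word set monoid" where
  "BT24 = presented_group bt_relations"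

definition bt_r :: "bt_letter word set" where "bt_r = pres_gen bt_relations LR"
definition bt_s :: "bt_letter word set" where "bt_s = pres_gen bt_relations LS"
definition bt_t :: "bt_letter word set" where "bt_t = pres_gen bt_relations LT"

lemma group_BT24: "group BT24"
  unfolding BT24_def by (rule group_presented_group)

lemma bt_relations_hold:
  "bt_r \<otimes>\<^bsub>BT24\<^esub> bt_r = bt_s \<otimes>\<^bsub>BT24\<^esub> bt_s \<otimes>\<^bsub>BT24\<^esub> bt_s"
  "bt_s \<otimes>\<^bsub>BT24\<^esub> bt_s \<otimes>\<^bsub>BT24\<^esub> bt_s = bt_t \<otimes>\<^bsub>BT24\<^esub> bt_t \<otimes>\<^bsub>BT24\<^esub> bt_t"
  "bt_t \<otimes>\<^bsub>BT24\<^esub> bt_t \<otimes>\<^bsub>BT24\<^esub> bt_t = bt_r \<otimes>\<^bsub>BT24\<^esub> bt_s \<otimes>\<^bsub>BT24\<^esub> bt_t"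
  unfolding BT24_def bt_r_def bt_s_def bt_t_def pres_gen_def
  by (simp_all add: mult_word_class word_class_eq_iff)
    (auto simp: bt_relations_def Let_def intro: pres_eq.relation)

lemma central_bt_r_square: "{\<one>\<^bsub>BT24\<^esub>, bt_r [^]\<^bsub>BT24\<^esub> (2 :: nat)} \<subseteq> group_center BT24"
proof -
  interpret group BT24 by (rule group_BT24)
  have mult: "word_class bt_relations u \<otimes>\<^bsub>BT24\<^esub> word_class bt_relations v =
      word_class bt_relations (u @ v)" for u v
    by (simp add: BT24_def mult_word_class)
  have cl: "word_class bt_relations u \<in> carrier BT24" for u
    by (simp add: BT24_def presented_group_def)
  have one: "word_class bt_relations [] = \<one>\<^bsub>BT24\<^esub>"
    by (simp add: BT24_def presented_group_def)
  have gens: "pres_gen bt_relations x \<in> carrier BT24" for x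
    by (simp add: pres_gen_def cl)
  note rst = gens[of LR, folded bt_r_def] gens[of LS, folded bt_s_def] gens[of LT, folded bt_t_def]
  define z where "z = bt_r \<otimes>\<^bsub>BT24\<^esub> bt_r"
  have z: "z \<in> carrier BT24" by (simp add: z_def rst)
  have zs: "z = bt_s \<otimes>\<^bsub>BT24\<^esub> bt_s \<otimes>\<^bsub>BT24\<^esub> bt_s"
    unfolding z_def by (rule bt_relations_hold)
  have zt: "z = bt_t \<otimes>\<^bsub>BT24\<^esub> bt_t \<otimes>\<^bsub>BT24\<^esub> bt_t"
    unfolding zs by (rule bt_relations_hold)
  have "z \<otimes>\<^bsub>BT24\<^esub> bt_r = bt_r \<otimes>\<^bsub>BT24\<^esub> z"
    by (simp add: z_def rst m_assoc)
  moreover have "z \<otimes>\<^bsub>BT24\<^esub> bt_s = bt_s \<otimes>\<^bsub>BT24\<^esub> z"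
    by (simp add: zs rst m_assoc)
  moreover have "z \<otimes>\<^bsub>BT24\<^esub> bt_t = bt_t \<otimes>\<^bsub>BT24\<^esub> z"
    by (simp add: zt rst m_assoc)
  ultimately have gen: "z \<otimes>\<^bsub>BT24\<^esub> pres_gen bt_relations x = pres_gen bt_relations x \<otimes>\<^bsub>BT24\<^esub> z" for x
    by (cases x) (simp_all add: bt_r_def bt_s_def bt_t_def)
  have letter: "z \<otimes>\<^bsub>BT24\<^esub> word_class bt_relations [(x, e)] =
      word_class bt_relations [(x, e)] \<otimes>\<^bsub>BT24\<^esub> z" for x e
  proof (cases e)
    case True
    then show ?thesis using gen[of x] by (simp add: pres_gen_def)
  next
    case False
    let ?g = "pres_gen bt_relations x" and ?i = "word_class bt_relations [(x, False)]"
    have gi: "?g \<otimes>\<^bsub>BT24\<^esub> ?i = \<one>\<^bsub>BT24\<^esub>" and ig: "?i \<otimes>\<^bsub>BT24\<^esub> ?g = \<one>\<^bsub>BT24\<^esub>"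
      using pres_eq.cancel[of bt_relations x True] pres_eq.cancel[of bt_relations x False]
      by (simp_all add: pres_gen_def mult word_class_eq_iff flip: one)
    have "z \<otimes>\<^bsub>BT24\<^esub> ?i = ?i \<otimes>\<^bsub>BT24\<^esub> ?g \<otimes>\<^bsub>BT24\<^esub> (z \<otimes>\<^bsub>BT24\<^esub> ?i)"
      by (simp add: ig z cl)
    also have "\<dots> = ?i \<otimes>\<^bsub>BT24\<^esub> (?g \<otimes>\<^bsub>BT24\<^esub> z) \<otimes>\<^bsub>BT24\<^esub> ?i"
      by (simp add: z cl gens m_assoc)
    also have "\<dots> = ?i \<otimes>\<^bsub>BT24\<^esub> (z \<otimes>\<^bsub>BT24\<^esub> ?g) \<otimes>\<^bsub>BT24\<^esub> ?i"
      by (simp only: gen)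
    also have "\<dots> = ?i \<otimes>\<^bsub>BT24\<^esub> z"
      by (simp add: z cl gens m_assoc gi)
    finally show ?thesis using False by simp
  qed
  have word: "z \<otimes>\<^bsub>BT24\<^esub> word_class bt_relations u = word_class bt_relations u \<otimes>\<^bsub>BT24\<^esub> z" for u
  proof (induction u)
    case Nil
    show ?case by (simp add: one z)
  next
    case (Cons a u)
    obtain x e where a: "a = (x, e)" by (cases a)
    let ?a = "word_class bt_relations [(x, e)]" and ?u = "word_class bt_relations u"
    have "z \<otimes>\<^bsub>BT24\<^esub> (?a \<otimes>\<^bsub>BT24\<^esub> ?u) = ?a \<otimes>\<^bsub>BT24\<^esub> (z \<otimes>\<^bsub>BT24\<^esub> ?u)"
      using letter[of x e] by (simp add: z cl flip: m_assoc)
    also have "\<dots> = ?a \<otimes>\<^bsub>BT24\<^esub> ?u \<otimes>\<^bsub>BT24\<^esub> z"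
      by (simp add: Cons.IH z cl m_assoc)
    finally show ?case by (simp add: mult a)
  qed
  have "z \<otimes>\<^bsub>BT24\<^esub> x = x \<otimes>\<^bsub>BT24\<^esub> z" if x: "x \<in> carrier BT24" for x
  proof -
    obtain u where "x = word_class bt_relations u"
      using x by (auto simp: BT24_def presented_group_def)
    then show ?thesis by (simp only: word)
  qed
  moreover have "bt_r [^]\<^bsub>BT24\<^esub> (2 :: nat) = z"
    by (simp add: z_def numeral_2_eq_2 rst)
  ultimately show ?thesis
    by (auto simp: group_center_def z)
qed

text \<open>
  \<open>Z(BT24) = {1, r\<^sup>2}\<close>: the set is defined as the centre. It contains \<open>1\<close> and \<open>r\<^sup>2\<close> by the
  preceding lemma; that it has exactly two elements is not used here.
\<close>

definition BT_B1 :: "bt_letter word set set" where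
  "BT_B1 = group_center BT24"

definition BT_B2 :: "bt_letter word set set" where
  "BT_B2 = {bt_r, inv\<^bsub>BT24\<^esub> bt_r}"

definition BT_B3 :: "bt_letter word set set" where
  "BT_B3 = {bt_t \<otimes>\<^bsub>BT24\<^esub> bt_s, inv\<^bsub>BT24\<^esub> bt_s \<otimes>\<^bsub>BT24\<^esub> inv\<^bsub>BT24\<^esub> bt_t}"

definition BT_B4 :: "bt_letter word set set" where
  "BT_B4 = {bt_t \<otimes>\<^bsub>BT24\<^esub> bt_s \<otimes>\<^bsub>BT24\<^esub> bt_r,
            inv\<^bsub>BT24\<^esub> bt_s \<otimes>\<^bsub>BT24\<^esub> inv\<^bsub>BT24\<^esub> bt_t \<otimes>\<^bsub>BT24\<^esub> bt_r}"

definition BT_C1 :: "bt_letter word set set" where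
  "BT_C1 = {bt_s, inv\<^bsub>BT24\<^esub> bt_s, bt_s [^]\<^bsub>BT24\<^esub> (-2 :: int), bt_t \<otimes>\<^bsub>BT24\<^esub> bt_r}"

definition BT_C2 :: "bt_letter word set set" where
  "BT_C2 = {bt_r \<otimes>\<^bsub>BT24\<^esub> bt_t, inv\<^bsub>BT24\<^esub> bt_r \<otimes>\<^bsub>BT24\<^esub> bt_t,
            inv\<^bsub>BT24\<^esub> bt_t \<otimes>\<^bsub>BT24\<^esub> inv\<^bsub>BT24\<^esub> bt_r, inv\<^bsub>BT24\<^esub> bt_t \<otimes>\<^bsub>BT24\<^esub> bt_r}"

definition BT_C3 :: "bt_letter word set set" where
  "BT_C3 = {bt_t, inv\<^bsub>BT24\<^esub> bt_t,
            bt_r \<otimes>\<^bsub>BT24\<^esub> bt_s, inv\<^bsub>BT24\<^esub> bt_s \<otimes>\<^bsub>BT24\<^esub> inv\<^bsub>BT24\<^esub> bt_r}"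

definition BT_C4 :: "bt_letter word set set" where
  "BT_C4 = {bt_s \<otimes>\<^bsub>BT24\<^esub> bt_r, inv\<^bsub>BT24\<^esub> bt_t \<otimes>\<^bsub>BT24\<^esub> bt_s,
            inv\<^bsub>BT24\<^esub> bt_s \<otimes>\<^bsub>BT24\<^esub> bt_t, inv\<^bsub>BT24\<^esub> bt_r \<otimes>\<^bsub>BT24\<^esub> inv\<^bsub>BT24\<^esub> bt_s}"

section \<open>Graphs\<close>

text \<open>
  A simple graph is a loop-free symmetric digraph without parallel arcs: every undirected edge
  is represented by its two orientations.
\<close>

definition commuting_graph :: "('a, 'm) monoid_scheme \<Rightarrow> 'a set \<Rightarrow> 'a pair_pre_digraph" where
  "commuting_graph H \<Gamma> =
    \<lparr>pverts = \<Gamma>,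
     parcs = {(x, y). x \<in> \<Gamma> \<and> y \<in> \<Gamma> \<and> x \<noteq> y \<and> x \<otimes>\<^bsub>H\<^esub> y = y \<otimes>\<^bsub>H\<^esub> x}\<rparr>"

definition complete_graph :: "nat \<Rightarrow> nat pair_pre_digraph" where
  "complete_graph m =
    \<lparr>pverts = {..<m}, parcs = {(i, j). i < m \<and> j < m \<and> i \<noteq> j}\<rparr>"

definition graph_copies :: "nat \<Rightarrow> 'a pair_pre_digraph \<Rightarrow> (nat \<times> 'a) pair_pre_digraph" where
  "graph_copies n G =
    \<lparr>pverts = {..<n} \<times> pverts G,
     parcs = {((i, x), (j, y)). i < n \<and> j = i \<and> (x, y) \<in> parcs G}\<rparr>"

definition graph_disj_union ::
    "'a pair_pre_digraph \<Rightarrow> 'b pair_pre_digraph \<Rightarrow> ('a + 'b) pair_pre_digraph" where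
  "graph_disj_union G1 G2 =
    \<lparr>pverts = pverts G1 <+> pverts G2,
     parcs = map_prod Inl Inl ` parcs G1 \<union> map_prod Inr Inr ` parcs G2\<rparr>"

text \<open>The node sets of the two operands of a join are made disjoint by the sum type.\<close>

definition graph_join ::
    "'a pair_pre_digraph \<Rightarrow> 'b pair_pre_digraph \<Rightarrow> ('a + 'b) pair_pre_digraph" where
  "graph_join G1 G2 =
    \<lparr>pverts = pverts G1 <+> pverts G2,
     parcs = parcs (graph_disj_union G1 G2) \<union>
       (Inl ` pverts G1 \<times> Inr ` pverts G2) \<union> (Inr ` pverts G2 \<times> Inl ` pverts G1)\<rparr>"

lemma pair_graph_commuting_graph: "finite \<Gamma> \<Longrightarrow> pair_graph (commuting_graph H \<Gamma>)"
  by unfold_locales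
    (auto simp: commuting_graph_def symmetric_def sym_def
      intro: finite_subset[of _ "\<Gamma> \<times> \<Gamma>"])

lemma pair_graph_complete_graph: "pair_graph (complete_graph m)"
  by unfold_locales
    (auto simp: complete_graph_def symmetric_def sym_def
      intro: finite_subset[of _ "{..<m} \<times> {..<m}"])

lemma complete_digraph_complete_graph: "K\<^bsub>m\<^esub> (with_proj (complete_graph m))"
  unfolding complete_digraph_pair_def
  by (auto simp: complete_graph_def)

end

theory Submission
  imports Defs Complex_Main
begin

text \<open>
  The relations give \<open>r = st\<close>, \<open>tst = s\<^sup>2\<close>, \<open>sts = t\<^sup>2\<close> and \<open>z\<^sup>2 = 1\<close> for the central element
  \<open>z = r\<^sup>2 = s\<^sup>3 = t\<^sup>3\<close>; rewriting with them leaves at most 24 elements. Sending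
  \<open>r, s, t\<close> to \<open>j, (1 + i + j + k)/2, (1 + i + j - k)/2\<close> defines a homomorphism into the unit
  quaternions with 24 distinct values on the listed elements, so it is injective. Commutation
  can therefore be read off quaternions, where non-central elements commute exactly if their
  vector parts are parallel. The vector parts lie on seven lines: the three coordinate axes,
  which give the sets \<open>B\<^sub>2, B\<^sub>3, B\<^sub>4\<close>, and the four diagonals of the cube, which give the
  sets \<open>C\<^sub>1, \<dots>, C\<^sub>4\<close>.
\<close>

section \<open>Upper bound on the order\<close>

text \<open>Computing in an arbitrary group with these relations lets the simplifier work with plain
  group products instead of classes of words.\<close>

locale binary_tetrahedral = group G for G (structure) +
  fixes r s t
  assumes closed [simp]: "r \<in> carrier G" "s \<in> carrier G" "t \<in> carrier G"
    and rr: "r \<otimes> r = s \<otimes> s \<otimes> s"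
    and sss: "s \<otimes> s \<otimes> s = t \<otimes> t \<otimes> t"
    and ttt: "t \<otimes> t \<otimes> t = r \<otimes> s \<otimes> t"
begin

section \<open>Consequences of the defining relations\<close>

definition z where "z = r \<otimes> r"

lemma z_closed [simp]: "z \<in> carrier G"
  by (simp add: z_def)

text \<open>Cancel the left \<open>r\<close> in \<open>r r = r s t\<close>. From here on
  \<open>r\<close> is eliminated in favour of \<open>s\<close> and \<open>t\<close>.\<close>

lemma r_eq: "r = s \<otimes> t"
proof -
  have "r \<otimes> r = r \<otimes> (s \<otimes> t)"
    using rr sss ttt by (simp add: m_assoc)
  then show ?thesis by simp
qed

text \<open>Products are kept nested to the right, where a rule for a three-letter word matches only
  at the end of a longer word. Appending a tail \<open>x\<close> makes it match inside as
  well.\<close>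

lemma extend_rule:
  assumes "a \<otimes> (b \<otimes> c) = d" "a \<in> carrier G" "b \<in> carrier G" "c \<in> carrier G" "x \<in> carrier G"
  shows "a \<otimes> (b \<otimes> (c \<otimes> x)) = d \<otimes> x"
  using assms by (metis m_assoc m_closed)

lemma cube_s: "s \<otimes> (s \<otimes> s) = z"
  using rr by (simp add: z_def m_assoc)

lemma cube_t: "t \<otimes> (t \<otimes> t) = z"
  using rr sss by (simp add: z_def m_assoc)

text \<open>With \<open>r = s t\<close>, cancel the first \<open>s\<close> in
  \<open>s t s t = s s s\<close>. Dually, \<open>sts\<close> cancels the last \<open>t\<close> in
  \<open>s t s t = t t t\<close>.\<close>

lemma tst: "t \<otimes> (s \<otimes> t) = s \<otimes> s"
proof -
  have "s \<otimes> (t \<otimes> (s \<otimes> t)) = s \<otimes> (s \<otimes> s)"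
    using rr by (simp add: r_eq m_assoc)
  then show ?thesis by simp
qed

lemma sts: "s \<otimes> (t \<otimes> s) = t \<otimes> t"
proof -
  have "s \<otimes> (t \<otimes> s) \<otimes> t = t \<otimes> t \<otimes> t"
    using rr sss by (simp add: r_eq m_assoc)
  then show ?thesis by simp
qed

lemma z_s: "s \<otimes> z = z \<otimes> s"
  by (simp add: m_assoc flip: cube_s)

lemma z_t: "t \<otimes> z = z \<otimes> t"
  by (simp add: m_assoc flip: cube_t)

lemma z_left: "x \<in> carrier G \<Longrightarrow> s \<otimes> (z \<otimes> x) = z \<otimes> (s \<otimes> x)"
  "x \<in> carrier G \<Longrightarrow> t \<otimes> (z \<otimes> x) = z \<otimes> (t \<otimes> x)"
  using z_s z_t by (simp_all flip: m_assoc)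

lemmas ext = cube_s [THEN extend_rule] cube_t [THEN extend_rule]

lemmas braid = tst sts tst [THEN extend_rule] sts [THEN extend_rule]

lemmas basic = cube_s cube_t ext z_s z_t z_left m_assoc

text \<open>Evaluate \<open>s\<^sup>4 = (tst)\<^sup>2\<close> in two ways: \<open>(tst)\<^sup>2 = t (s t\<^sup>2 s) t = t s\<^sup>2 t s\<^sup>2 t = t\<^sup>2 s t\<^sup>3 s t\<^sup>2 = z\<^sup>3 s\<close>.\<close>

lemma z_square: "z \<otimes> z = \<one>"
proof -
  have "z \<otimes> s = (t \<otimes> s \<otimes> t) \<otimes> (t \<otimes> s \<otimes> t)"
    by (simp add: basic tst)
  also have "\<dots> = t \<otimes> s \<otimes> (t \<otimes> t) \<otimes> (s \<otimes> t)"
    by (simp add: m_assoc)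
  also have "\<dots> = t \<otimes> (s \<otimes> s) \<otimes> t \<otimes> (s \<otimes> s) \<otimes> t"
    by (simp add: m_assoc flip: sts)
  also have "\<dots> = t \<otimes> t \<otimes> s \<otimes> (t \<otimes> t \<otimes> t) \<otimes> s \<otimes> (t \<otimes> t)"
    by (simp add: m_assoc flip: tst)
  also have "\<dots> = z \<otimes> (t \<otimes> t \<otimes> (s \<otimes> s) \<otimes> t \<otimes> t)"
    by (simp add: basic)
  also have "\<dots> = z \<otimes> (z \<otimes> (z \<otimes> s))"
    by (simp add: basic flip: tst)
  finally have "z \<otimes> s = (z \<otimes> z) \<otimes> (z \<otimes> s)"
    by (simp add: m_assoc)
  then show ?thesis
    by (metis closed(2) m_closed r_cancel_one' z_closed)
qed

lemma z_cancel: "x \<in> carrier G \<Longrightarrow> z \<otimes> (z \<otimes> x) = x"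
  by (simp add: z_square flip: m_assoc)

text \<open>Write \<open>z\<close> as \<open>t t t\<close> at the right end:
  \<open>z t s = t s t t t\<close>, and the leading \<open>t s t\<close> becomes \<open>s s\<close>.
  The same argument with \<open>s\<close> and \<open>t\<close> exchanged gives
  \<open>ttss\<close>.\<close>

lemma sstt: "s \<otimes> (s \<otimes> (t \<otimes> t)) = z \<otimes> (t \<otimes> s)"
proof -
  have "z \<otimes> (t \<otimes> s) = t \<otimes> (s \<otimes> (t \<otimes> (t \<otimes> t)))"
    by (simp add: basic)
  then show ?thesis by (simp add: braid m_assoc)
qed

text \<open>The rule \<open>sstt\<close> matches only at the end of a word. This variant handles
  \<open>s\<close> times the normal form \<open>s t t s\<close>.\<close>

lemma sstt_s: "s \<otimes> (s \<otimes> (t \<otimes> (t \<otimes> s))) = z \<otimes> (t \<otimes> (s \<otimes> s))"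
proof -
  have "s \<otimes> (s \<otimes> (t \<otimes> t)) \<otimes> s = z \<otimes> (t \<otimes> s) \<otimes> s"
    by (simp only: sstt)
  then show ?thesis by (simp add: m_assoc)
qed

lemma ttss: "t \<otimes> (t \<otimes> (s \<otimes> s)) = z \<otimes> (s \<otimes> t)"
proof -
  have "z \<otimes> (s \<otimes> t) = s \<otimes> (t \<otimes> (s \<otimes> (s \<otimes> s)))"
    by (simp add: basic)
  then show ?thesis by (simp add: braid m_assoc)
qed

text \<open>Expand \<open>t t\<close> to \<open>s t s\<close>, then both squares \<open>s s\<close>
  to \<open>t s t\<close>: \<open>s t t s = s s t s s = t s t t t s t\<close>. The cube in the
  middle is \<open>z\<close>, which is its own inverse.\<close>

lemma tsst: "t \<otimes> (s \<otimes> (s \<otimes> t)) = z \<otimes> (s \<otimes> (t \<otimes> (t \<otimes> s)))"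
proof -
  have "s \<otimes> (t \<otimes> t) \<otimes> s = (s \<otimes> s) \<otimes> t \<otimes> (s \<otimes> s)"
    by (simp add: m_assoc flip: sts)
  also have "\<dots> = z \<otimes> (t \<otimes> (s \<otimes> (s \<otimes> t)))"
    by (simp add: basic flip: tst)
  finally show ?thesis by (simp add: m_assoc z_cancel)
qed

text \<open>Oriented left to right, these equations reduce every word in \<open>s\<close> and \<open>t\<close> to one of 24 normal forms.\<close>

lemmas rewrite = basic braid z_square z_cancel sstt ttss tsst sstt_s

section \<open>Twelve normal forms and their multiples by \<open>z\<close>\<close>

definition normal_forms where
  "normal_forms =
    (let ws = [\<one>, s, t, s \<otimes> s, s \<otimes> t, t \<otimes> s, t \<otimes> t, s \<otimes> (s \<otimes> t), s \<otimes> (t \<otimes> t),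
        t \<otimes> (s \<otimes> s), t \<otimes> (t \<otimes> s), s \<otimes> (t \<otimes> (t \<otimes> s))]
     in ws @ map ((\<otimes>) z) ws)"

text \<open>The length of the list is the bound; the matching lower bound on the order comes from
  the quaternions.\<close>

lemma card_normal_forms: "card (set normal_forms) \<le> 24"
  by (rule order_trans [OF card_length]) (simp add: normal_forms_def Let_def)

lemma normal_forms_closed:
  "set normal_forms \<subseteq> carrier G" "\<one> \<in> set normal_forms"
  by (auto simp: normal_forms_def Let_def)

lemma normal_forms_mult_s: "x \<in> set normal_forms \<Longrightarrow> s \<otimes> x \<in> set normal_forms"
  by (auto simp: normal_forms_def Let_def rewrite)

lemma normal_forms_mult_t: "x \<in> set normal_forms \<Longrightarrow> t \<otimes> x \<in> set normal_forms"
  by (auto simp: normal_forms_def Let_def rewrite)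

lemma normal_forms_mult_r: "x \<in> set normal_forms \<Longrightarrow> r \<otimes> x \<in> set normal_forms"
  using normal_forms_mult_s [OF normal_forms_mult_t] normal_forms_closed(1)
  by (auto simp: r_eq m_assoc)

end

text \<open>Induction on words, splitting off the first letter. Closure under inverse letters
  follows from finiteness: an injective map of \<open>N\<close> into itself is onto.\<close>

lemma carrier_presented_group_subset:
  assumes "finite N" "N \<subseteq> carrier (presented_group R)" "\<one>\<^bsub>presented_group R\<^esub> \<in> N"
    and mult: "\<And>x a. a \<in> N \<Longrightarrow> pres_gen R x \<otimes>\<^bsub>presented_group R\<^esub> a \<in> N"
  shows "carrier (presented_group R) \<subseteq> N"
proof -
  interpret group "presented_group R" by (rule group_presented_group)
  have carrier: "word_class R u \<in> carrier (presented_group R)" for u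
    by (simp add: presented_group_def)
  have "word_class R u \<in> N" for u
  proof (induction u)
    case Nil
    then show ?case using assms(3) by (simp add: presented_group_def)
  next
    case (Cons a u)
    obtain x e where a: "a = (x, e)" by (cases a)
    let ?g = "pres_gen R x"
    have split: "word_class R (a # u) =
        word_class R [(x, e)] \<otimes>\<^bsub>presented_group R\<^esub> word_class R u"
      by (simp add: mult_word_class a)
    show ?case
    proof (cases e)
      case True
      then show ?thesis
        using mult [OF Cons.IH, of x] by (simp add: split pres_gen_def)
    next
      case False
      \<comment> \<open>left multiplication by a generator permutes the finite set \<open>N\<close>\<close>
      have "inj_on ((\<otimes>\<^bsub>presented_group R\<^esub>) ?g) N"
        using assms(2) carrier
        by (intro inj_onI) (metis Units_eq Units_l_cancel pres_gen_def subsetD)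
      then have "(\<otimes>\<^bsub>presented_group R\<^esub>) ?g ` N = N"
        using mult \<open>finite N\<close> by (intro endo_inj_surj) auto
      \<comment> \<open>The inverse letter strips \<open>?g\<close> from \<open>?g b\<close>, so the
        longer word evaluates to \<open>b\<close>, which lies in \<open>N\<close>.\<close>
      then obtain b where b: "b \<in> N" "word_class R u = ?g \<otimes>\<^bsub>presented_group R\<^esub> b"
        using Cons.IH by (metis imageE)
      have "word_class R [(x, e)] \<otimes>\<^bsub>presented_group R\<^esub> ?g = \<one>\<^bsub>presented_group R\<^esub>"
        using pres_eq.cancel [of R x False] False
        by (simp add: pres_gen_def mult_word_class)
          (simp add: presented_group_def word_class_eq_iff)
      then have "word_class R (a # u) = b"
        unfolding split b(2) using b(1) assms(2) carrier
        by (subst m_assoc [symmetric]) (auto simp: pres_gen_def)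
      then show ?thesis using b(1) by simp
    qed
  qed
  then show ?thesis by (auto simp: presented_group_def)
qed

section \<open>The order of \<open>BT24\<close> is at most 24\<close>

interpretation BT24: binary_tetrahedral BT24 bt_r bt_s bt_t
proof (intro binary_tetrahedral.intro binary_tetrahedral_axioms.intro)
  show "group BT24" by (rule group_BT24)
qed (simp_all add: bt_relations_hold,
     simp_all add: bt_r_def bt_s_def bt_t_def pres_gen_def BT24_def presented_group_def)

lemma carrier_BT24_subset: "carrier BT24 \<subseteq> set BT24.normal_forms"
proof -
  have "pres_gen bt_relations x \<otimes>\<^bsub>BT24\<^esub> a \<in> set BT24.normal_forms"
    if "a \<in> set BT24.normal_forms" for x a
    using that BT24.normal_forms_mult_r BT24.normal_forms_mult_s BT24.normal_forms_mult_t
    by (cases x) (simp_all add: bt_r_def bt_s_def bt_t_def)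
  then show ?thesis
    using carrier_presented_group_subset [of "set BT24.normal_forms" bt_relations]
      BT24.normal_forms_closed
    by (auto simp: BT24_def)
qed

lemma card_BT24_le: "card (carrier BT24) \<le> 24" and finite_BT24: "finite (carrier BT24)"
  using carrier_BT24_subset BT24.card_normal_forms
  by (auto intro: order_trans [OF card_mono] finite_subset)

section \<open>Representation by unit quaternions\<close>

type_synonym quat = "real \<times> real \<times> real \<times> real"

text \<open>Hamilton's product in coordinates with respect to 1, i, j, k.\<close>

fun qmult :: "quat \<Rightarrow> quat \<Rightarrow> quat" where
  "qmult (a, b, c, d) (a', b', c', d') =
    (a * a' - b * b' - c * c' - d * d', a * b' + b * a' + c * d' - d * c',
     a * c' - b * d' + c * a' + d * b', a * d' + b * c' - c * b' + d * a')"

fun qconj :: "quat \<Rightarrow> quat" where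
  "qconj (a, b, c, d) = (a, - b, - c, - d)"

definition unit_quaternions :: "quat monoid" where
  "unit_quaternions =
    \<lparr>carrier = {(a, b, c, d). a\<^sup>2 + b\<^sup>2 + c\<^sup>2 + d\<^sup>2 = 1}, monoid.mult = qmult, one = (1, 0, 0, 0)\<rparr>"

lemma unit_quaternions_simps [simp]:
  "x \<otimes>\<^bsub>unit_quaternions\<^esub> y = qmult x y"
  "\<one>\<^bsub>unit_quaternions\<^esub> = (1, 0, 0, 0)"
  "(a, b, c, d) \<in> carrier unit_quaternions \<longleftrightarrow> a\<^sup>2 + b\<^sup>2 + c\<^sup>2 + d\<^sup>2 = 1"
  by (simp_all add: unit_quaternions_def)

lemma qconj_unit: "x \<in> carrier unit_quaternions \<Longrightarrow> qconj x \<in> carrier unit_quaternions"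
  by (cases x) simp

lemma qconj_qmult: "x \<in> carrier unit_quaternions \<Longrightarrow> qmult (qconj x) x = (1, 0, 0, 0)"
  by (cases x) (simp add: power2_eq_square algebra_simps)

lemma group_unit_quaternions: "group unit_quaternions"
proof (rule groupI)
  fix x y assume "x \<in> carrier unit_quaternions" "y \<in> carrier unit_quaternions"
  moreover obtain a b c d a' b' c' d' where "x = (a, b, c, d)" "y = (a', b', c', d')"
    by (cases x, cases y)
  \<comment> \<open>Euler's four-square identity: the norm is multiplicative.\<close>
  moreover have "(a * a' - b * b' - c * c' - d * d')\<^sup>2 + (a * b' + b * a' + c * d' - d * c')\<^sup>2 +
      (a * c' - b * d' + c * a' + d * b')\<^sup>2 + (a * d' + b * c' - c * b' + d * a')\<^sup>2 =
      (a\<^sup>2 + b\<^sup>2 + c\<^sup>2 + d\<^sup>2) * (a'\<^sup>2 + b'\<^sup>2 + c'\<^sup>2 + d'\<^sup>2)"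
    by algebra
  ultimately show "x \<otimes>\<^bsub>unit_quaternions\<^esub> y \<in> carrier unit_quaternions"
    by simp
next
  fix x y w
  show "x \<otimes>\<^bsub>unit_quaternions\<^esub> y \<otimes>\<^bsub>unit_quaternions\<^esub> w =
      x \<otimes>\<^bsub>unit_quaternions\<^esub> (y \<otimes>\<^bsub>unit_quaternions\<^esub> w)"
    by (cases x, cases y, cases w) (simp add: algebra_simps)
next
  fix x assume x: "x \<in> carrier unit_quaternions"
  show "\<one>\<^bsub>unit_quaternions\<^esub> \<otimes>\<^bsub>unit_quaternions\<^esub> x = x"
    by (cases x) simp
  show "\<exists>y\<in>carrier unit_quaternions. y \<otimes>\<^bsub>unit_quaternions\<^esub> x = \<one>\<^bsub>unit_quaternions\<^esub>"
    using qconj_unit [OF x] qconj_qmult [OF x] by auto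
qed simp

lemma inv_unit_quaternions:
  "x \<in> carrier unit_quaternions \<Longrightarrow> inv\<^bsub>unit_quaternions\<^esub> x = qconj x"
  using group.inv_equality [OF group_unit_quaternions, of "qconj x" x]
  by (simp add: qconj_unit qconj_qmult)

fun quat_gen :: "bt_letter \<Rightarrow> quat" where
  "quat_gen LR = (0, 0, 1, 0)"
| "quat_gen LS = (1/2, 1/2, 1/2, 1/2)"
| "quat_gen LT = (1/2, 1/2, 1/2, -1/2)"

text \<open>The chosen quaternions satisfy \<open>s t = r\<close> and
  \<open>r r = s s s = t t t = -1\<close>, so the universal property applies.\<close>

lemma BT24_quaternion_hom:
  obtains h where "h \<in> hom BT24 unit_quaternions" "h bt_r = quat_gen LR"
    "h bt_s = quat_gen LS" "h bt_t = quat_gen LT"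
proof -
  have "quat_gen x \<in> carrier unit_quaternions" for x
    by (cases x) (simp_all add: power2_eq_square)
  then obtain h where "h \<in> hom (presented_group bt_relations) unit_quaternions"
      "\<And>x. h (pres_gen bt_relations x) = quat_gen x"
    by (rule presented_group_hom [OF group_unit_quaternions, of quat_gen bt_relations])
      (auto simp: bt_relations_def Let_def)
  then show ?thesis
    by (intro that [of h]) (simp_all add: BT24_def bt_r_def bt_s_def bt_t_def)
qed

section \<open>Labelling the nodes of the target graph\<close>

type_synonym node = "nat + (nat \<times> nat + nat \<times> nat)"

definition target_graph :: "node pair_pre_digraph" where
  "target_graph = graph_join (complete_graph 2)
     (graph_disj_union (graph_copies 3 (complete_graph 2)) (graph_copies 4 (complete_graph 4)))"

text \<open>The two central nodes carry 1 and -1. The pairs lie on the axes j, i, k in this order;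
  each row of four lies on one diagonal of the cube, with all sign choices for real and vector
  part.\<close>

fun node_quat :: "node \<Rightarrow> quat" where
  "node_quat (Inl i) = [(1, 0, 0, 0), (-1, 0, 0, 0)] ! i"
| "node_quat (Inr (Inl (i, j))) =
    [[(0, 0, 1, 0), (0, 0, -1, 0)],
     [(0, 1, 0, 0), (0, -1, 0, 0)],
     [(0, 0, 0, 1), (0, 0, 0, -1)]] ! i ! j"
| "node_quat (Inr (Inr (i, j))) =
    [[(1/2, 1/2, 1/2, 1/2), (1/2, -1/2, -1/2, -1/2),
      (-1/2, -1/2, -1/2, -1/2), (-1/2, 1/2, 1/2, 1/2)],
     [(-1/2, -1/2, 1/2, -1/2), (1/2, 1/2, -1/2, 1/2),
      (-1/2, 1/2, -1/2, 1/2), (1/2, -1/2, 1/2, -1/2)],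
     [(1/2, 1/2, 1/2, -1/2), (1/2, -1/2, -1/2, 1/2),
      (-1/2, 1/2, 1/2, -1/2), (-1/2, -1/2, -1/2, 1/2)],
     [(-1/2, -1/2, 1/2, 1/2), (1/2, -1/2, 1/2, 1/2),
      (1/2, 1/2, -1/2, -1/2), (-1/2, 1/2, -1/2, -1/2)]] ! i ! j"

text \<open>Same layout as \<open>node_quat\<close>. The rows list \<open>BT_B2\<close>,
  \<open>BT_B3\<close>, \<open>BT_B4\<close> and then \<open>BT_C1\<close> to \<open>BT_C4\<close>,
  so each of these sets is the image of one row of labels.\<close>

fun node_elem :: "node \<Rightarrow> bt_letter word set" where
  "node_elem (Inl i) = [\<one>\<^bsub>BT24\<^esub>, bt_r \<otimes>\<^bsub>BT24\<^esub> bt_r] ! i"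
| "node_elem (Inr (Inl (i, j))) =
    [[bt_r, inv\<^bsub>BT24\<^esub> bt_r],
     [bt_t \<otimes>\<^bsub>BT24\<^esub> bt_s, inv\<^bsub>BT24\<^esub> bt_s \<otimes>\<^bsub>BT24\<^esub> inv\<^bsub>BT24\<^esub> bt_t],
     [bt_t \<otimes>\<^bsub>BT24\<^esub> bt_s \<otimes>\<^bsub>BT24\<^esub> bt_r,
      inv\<^bsub>BT24\<^esub> bt_s \<otimes>\<^bsub>BT24\<^esub> inv\<^bsub>BT24\<^esub> bt_t \<otimes>\<^bsub>BT24\<^esub> bt_r]] ! i ! j"
| "node_elem (Inr (Inr (i, j))) =
    [[bt_s, inv\<^bsub>BT24\<^esub> bt_s, bt_s [^]\<^bsub>BT24\<^esub> (-2 :: int), bt_t \<otimes>\<^bsub>BT24\<^esub> bt_r],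
     [bt_r \<otimes>\<^bsub>BT24\<^esub> bt_t, inv\<^bsub>BT24\<^esub> bt_r \<otimes>\<^bsub>BT24\<^esub> bt_t,
      inv\<^bsub>BT24\<^esub> bt_t \<otimes>\<^bsub>BT24\<^esub> inv\<^bsub>BT24\<^esub> bt_r, inv\<^bsub>BT24\<^esub> bt_t \<otimes>\<^bsub>BT24\<^esub> bt_r],
     [bt_t, inv\<^bsub>BT24\<^esub> bt_t,
      bt_r \<otimes>\<^bsub>BT24\<^esub> bt_s, inv\<^bsub>BT24\<^esub> bt_s \<otimes>\<^bsub>BT24\<^esub> inv\<^bsub>BT24\<^esub> bt_r],
     [bt_s \<otimes>\<^bsub>BT24\<^esub> bt_r, inv\<^bsub>BT24\<^esub> bt_t \<otimes>\<^bsub>BT24\<^esub> bt_s,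
      inv\<^bsub>BT24\<^esub> bt_s \<otimes>\<^bsub>BT24\<^esub> bt_t, inv\<^bsub>BT24\<^esub> bt_r \<otimes>\<^bsub>BT24\<^esub> inv\<^bsub>BT24\<^esub> bt_s]] ! i ! j"

text \<open>Models commutation rather than adjacency: it is reflexive, and distinctness is added in
  \<open>parcs_target_graph\<close>.\<close>

fun node_adj :: "node \<Rightarrow> node \<Rightarrow> bool" where
  "node_adj (Inr (Inl (i, _))) (Inr (Inl (k, _))) \<longleftrightarrow> i = k"
| "node_adj (Inr (Inr (i, _))) (Inr (Inr (k, _))) \<longleftrightarrow> i = k"
| "node_adj (Inl _) _ \<longleftrightarrow> True"
| "node_adj _ (Inl _) \<longleftrightarrow> True"
| "node_adj _ _ \<longleftrightarrow> False"

lemma pverts_target_graph: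
  "pverts target_graph = {..<2} <+> ({..<3} \<times> {..<2} <+> {..<4} \<times> {..<4})"
  by (simp add: target_graph_def graph_join_def graph_disj_union_def graph_copies_def
      complete_graph_def)

lemma parcs_target_graph:
  "parcs target_graph =
    {(u, v). u \<in> pverts target_graph \<and> v \<in> pverts target_graph \<and> u \<noteq> v \<and> node_adj u v}"
  unfolding pverts_target_graph
  by (auto simp: target_graph_def graph_join_def graph_disj_union_def graph_copies_def
      complete_graph_def image_iff)

lemma lessThan_numerals: "{..<2::nat} = {0, 1}" "{..<3::nat} = {0, 1, 2}" "{..<4::nat} = {0, 1, 2, 3}"
  by auto

lemma pverts_target_graph_cases:
  assumes "v \<in> pverts target_graph"
  obtains i where "i \<in> {0, 1}" "v = Inl i"
    | i j where "i \<in> {0, 1, 2}" "j \<in> {0, 1}" "v = Inr (Inl (i, j))"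
    | i j where "i \<in> {0, 1, 2, 3}" "j \<in> {0, 1, 2, 3}" "v = Inr (Inr (i, j))"
  using assms unfolding pverts_target_graph lessThan_numerals by blast

lemma inj_on_node_quat: "inj_on node_quat (pverts target_graph)"
proof (rule inj_onI)
  fix u v assume "u \<in> pverts target_graph" "v \<in> pverts target_graph" "node_quat u = node_quat v"
  then show "u = v"
    by (elim pverts_target_graph_cases) auto
qed

text \<open>Quaternions commute exactly if the cross product of their vector parts vanishes. For
  these finitely many labels the equation is checked case by case.\<close>

lemma node_quat_commute_iff:
  assumes "u \<in> pverts target_graph" "v \<in> pverts target_graph"
  shows "qmult (node_quat u) (node_quat v) = qmult (node_quat v) (node_quat u) \<longleftrightarrow> node_adj u v"
  using assms by (elim pverts_target_graph_cases) auto

lemma bt_s_int_pow: "bt_s [^]\<^bsub>BT24\<^esub> (-2 :: int) = inv\<^bsub>BT24\<^esub> (bt_s \<otimes>\<^bsub>BT24\<^esub> bt_s)"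
  by (simp add: int_pow_def2 numeral_2_eq_2)

lemma node_elem_closed: "v \<in> pverts target_graph \<Longrightarrow> node_elem v \<in> carrier BT24"
  by (elim pverts_target_graph_cases) auto

text \<open>A homomorphism is determined by the images of the generators, so the two tables can be
  compared entry by entry.\<close>

lemma node_elem_hom:
  assumes "h \<in> hom BT24 unit_quaternions"
    and gens: "h bt_r = quat_gen LR" "h bt_s = quat_gen LS" "h bt_t = quat_gen LT"
    and v: "v \<in> pverts target_graph"
  shows "h (node_elem v) = node_quat v"
proof -
  interpret group_hom BT24 unit_quaternions h
    using assms(1) group_BT24 group_unit_quaternions
    by (simp add: group_hom_def group_hom_axioms_def)
  have inv_gens: "h (inv\<^bsub>BT24\<^esub> bt_r) = qconj (quat_gen LR)"
    "h (inv\<^bsub>BT24\<^esub> bt_s) = qconj (quat_gen LS)" "h (inv\<^bsub>BT24\<^esub> bt_t) = qconj (quat_gen LT)"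
    using BT24.closed [THEN hom_closed] by (simp_all add: inv_unit_quaternions gens)
  \<comment> \<open>This power is the one entry that is not already written with generators, their
    inverses, products and the identity.\<close>
  have "h (bt_s [^]\<^bsub>BT24\<^esub> (-2 :: int)) = qmult (qconj (quat_gen LS)) (qconj (quat_gen LS))"
    by (simp add: bt_s_int_pow BT24.inv_mult_group inv_gens)
  then show ?thesis
    using v hom_one by (elim pverts_target_graph_cases) (auto simp: gens inv_gens)
qed

section \<open>The labelling as a bijection that reflects commutation\<close>

lemma card_pverts_target_graph: "card (pverts target_graph) = 24"
  by (simp add: pverts_target_graph card_Plus)

text \<open>Since \<open>h\<close> after \<open>node_elem\<close> is the injective
  \<open>node_quat\<close>, the 24 labels name 24 distinct elements. By the upper bound these are
  all, so \<open>h\<close> is injective and commutation can be tested on quaternions.\<close>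

lemma bij_betw_node_elem: "bij_betw node_elem (pverts target_graph) (carrier BT24)"
  and node_elem_commute_iff:
    "\<lbrakk>u \<in> pverts target_graph; v \<in> pverts target_graph\<rbrakk> \<Longrightarrow>
      node_elem u \<otimes>\<^bsub>BT24\<^esub> node_elem v = node_elem v \<otimes>\<^bsub>BT24\<^esub> node_elem u \<longleftrightarrow> node_adj u v"
proof -
  obtain h where hom: "h \<in> hom BT24 unit_quaternions"
    and gens: "h bt_r = quat_gen LR" "h bt_s = quat_gen LS" "h bt_t = quat_gen LT"
    by (rule BT24_quaternion_hom)
  note h = node_elem_hom [OF hom gens]
  have inj_comp: "inj_on (h \<circ> node_elem) (pverts target_graph)"
    using inj_on_node_quat h by (simp cong: inj_on_cong)
  then have inj: "inj_on node_elem (pverts target_graph)"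
    by (rule inj_on_imageI2)
  \<comment> \<open>A subset of a finite set with at least as many elements is the whole
    set.\<close>
  then have "node_elem ` pverts target_graph = carrier BT24"
    using node_elem_closed card_BT24_le finite_BT24
    by (intro card_seteq) (auto simp: card_image card_pverts_target_graph)
  then show bij: "bij_betw node_elem (pverts target_graph) (carrier BT24)"
    using inj by (simp add: bij_betw_def)
  then have inj_h: "inj_on h (carrier BT24)"
    using inj_comp by (metis bij_betw_def inj_on_imageI)
  fix u v assume uv: "u \<in> pverts target_graph" "v \<in> pverts target_graph"
  have "node_elem u \<otimes>\<^bsub>BT24\<^esub> node_elem v = node_elem v \<otimes>\<^bsub>BT24\<^esub> node_elem u \<longleftrightarrow>
      h (node_elem u \<otimes>\<^bsub>BT24\<^esub> node_elem v) = h (node_elem v \<otimes>\<^bsub>BT24\<^esub> node_elem u)"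
    using uv node_elem_closed by (simp add: inj_on_eq_iff [OF inj_h])
  also have "\<dots> \<longleftrightarrow> node_adj u v"
    using uv node_elem_closed hom_mult [OF hom] by (simp add: h node_quat_commute_iff)
  finally show "node_elem u \<otimes>\<^bsub>BT24\<^esub> node_elem v = node_elem v \<otimes>\<^bsub>BT24\<^esub> node_elem u \<longleftrightarrow>
      node_adj u v" .
qed

text \<open>Under the labelling the centre corresponds to the nodes related to every node.\<close>

lemma group_center_BT24: "group_center BT24 = node_elem ` {Inl 0, Inl 1}"
proof -
  have "group_center BT24 = node_elem ` {u \<in> pverts target_graph. \<forall>v\<in>pverts target_graph. node_adj u v}"
    unfolding group_center_def bij_betw_imp_surj_on [OF bij_betw_node_elem, symmetric]
    by (intro subset_antisym)
      (auto simp: node_elem_commute_iff simp del: node_elem.simps del: subset_antisym)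
  also have "{u \<in> pverts target_graph. \<forall>v\<in>pverts target_graph. node_adj u v} = {Inl 0, Inl 1}"
  proof (intro subset_antisym subsetI)
    fix u assume u: "u \<in> {u \<in> pverts target_graph. \<forall>v\<in>pverts target_graph. node_adj u v}"
    \<comment> \<open>Two test nodes suffice: no node of a pair is related to one of a quadruple, so
      only the central labels are related to both.\<close>
    have "Inr (Inl (0, 0)) \<in> pverts target_graph" "Inr (Inr (0, 0)) \<in> pverts target_graph"
      by (auto simp: pverts_target_graph)
    with u have "u \<in> pverts target_graph" "node_adj u (Inr (Inl (0, 0)))"
        "node_adj u (Inr (Inr (0, 0)))"
      by blast+
    then show "u \<in> {Inl 0, Inl 1}"
      by (elim pverts_target_graph_cases) auto
  qed (auto simp: pverts_target_graph)
  finally show ?thesis .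
qed

section \<open>Graph isomorphisms\<close>

text \<open>Labellings run from the nodes of \<open>K\<close> to group elements, whereas the
  required isomorphism starts at the commuting graph. It is therefore the inverse of
  \<open>f\<close>, applied to both ends of each arc.\<close>

lemma digraph_iso_commuting_graph:
  assumes bij: "bij_betw f (pverts K) \<Gamma>"
    and arcs: "parcs K = {(u, v). u \<in> pverts K \<and> v \<in> pverts K \<and> u \<noteq> v \<and>
      f u \<otimes>\<^bsub>H\<^esub> f v = f v \<otimes>\<^bsub>H\<^esub> f u}"
  shows "digraph_iso (with_proj (commuting_graph H \<Gamma>)) (with_proj K)"
proof -
  let ?G = "with_proj (commuting_graph H \<Gamma>)"
  let ?g = "the_inv_into (pverts K) f"
  have g: "bij_betw ?g \<Gamma> (pverts K)"
    using bij by (rule bij_betw_the_inv_into)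
  have fg: "x \<in> \<Gamma> \<Longrightarrow> f (?g x) = x" for x
    using bij by (rule f_the_inv_into_f_bij_betw) auto
  have gf: "u \<in> pverts K \<Longrightarrow> ?g (f u) = u" for u
    using bij by (intro the_inv_into_f_f) (auto simp: bij_betw_def)
  define \<phi> where "\<phi> = \<lparr>iso_verts = ?g, iso_arcs = map_prod ?g ?g, iso_head = snd, iso_tail = fst\<rparr>"
  have sub: "parcs (commuting_graph H \<Gamma>) \<subseteq> \<Gamma> \<times> \<Gamma>"
    by (auto simp: commuting_graph_def)
  have "inj_on (map_prod ?g ?g) (parcs (commuting_graph H \<Gamma>))"
    using g by (intro inj_on_subset [OF map_prod_inj_on sub]) (auto simp: bij_betw_def)
  then have "pre_digraph.digraph_isomorphism ?G \<phi>"
    using g by (auto simp: pre_digraph.digraph_isomorphism_def \<phi>_def commuting_graph_def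
        bij_betw_def intro!: wf_digraph.intro)
  moreover have "map_prod ?g ?g ` parcs (commuting_graph H \<Gamma>) = parcs K"
  proof (intro subset_antisym subsetI)
    fix a assume "a \<in> map_prod ?g ?g ` parcs (commuting_graph H \<Gamma>)"
    then show "a \<in> parcs K"
      using g fg by (auto simp: arcs commuting_graph_def bij_betw_def dest: inj_onD)
  next
    fix a assume "a \<in> parcs K"
    then have "map_prod f f a \<in> parcs (commuting_graph H \<Gamma>)" "a = map_prod ?g ?g (map_prod f f a)"
      using bij gf by (auto simp: arcs commuting_graph_def bij_betw_def dest: inj_onD)
    then show "a \<in> map_prod ?g ?g ` parcs (commuting_graph H \<Gamma>)"
      by blast
  qed
  then have "with_proj K = app_iso \<phi> ?G"
    using g by (auto simp: app_iso_def \<phi>_def with_proj_def commuting_graph_def bij_betw_def)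
  ultimately show ?thesis
    unfolding digraph_iso_def by blast
qed

text \<open>In a commuting set all distinct elements are joined, so any enumeration is an
  isomorphism.\<close>

lemma digraph_iso_complete_graph:
  assumes "finite \<Gamma>" "card \<Gamma> = m"
    and comm: "\<And>x y. x \<in> \<Gamma> \<Longrightarrow> y \<in> \<Gamma> \<Longrightarrow> x \<otimes>\<^bsub>H\<^esub> y = y \<otimes>\<^bsub>H\<^esub> x"
  shows "digraph_iso (with_proj (commuting_graph H \<Gamma>)) (with_proj (complete_graph m))"
proof -
  obtain f where "bij_betw f {..<m} \<Gamma>"
    using ex_bij_betw_nat_finite [OF \<open>finite \<Gamma>\<close>] assms(2) by (auto simp: atLeast0LessThan)
  then show ?thesis
    using comm by (intro digraph_iso_commuting_graph [of f])
      (auto simp: complete_graph_def bij_betw_def)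
qed

text \<open>Mutually related labels name commuting elements, and injectivity of
  \<open>node_elem\<close> preserves their number.\<close>

lemma digraph_iso_commuting_clique:
  assumes "U \<subseteq> pverts target_graph" "\<And>u v. u \<in> U \<Longrightarrow> v \<in> U \<Longrightarrow> node_adj u v"
    and "\<Gamma> = node_elem ` U" "card U = m"
  shows "digraph_iso (with_proj (commuting_graph BT24 \<Gamma>)) (with_proj (complete_graph m))"
proof (rule digraph_iso_complete_graph)
  have "finite U"
    using assms(1) by (rule finite_subset) (simp add: pverts_target_graph)
  then show "finite \<Gamma>"
    by (simp add: assms(3))
  show "card \<Gamma> = m"
    using bij_betw_node_elem assms by (auto simp: bij_betw_def intro: card_image inj_on_subset)
qed (use assms node_elem_commute_iff in blast)

lemma digraph_iso_K2:
  assumes "i < 3" "\<Gamma> = node_elem ` (\<lambda>j. Inr (Inl (i, j))) ` {..<2}"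
  shows "digraph_iso (with_proj (commuting_graph BT24 \<Gamma>)) (with_proj (complete_graph 2))"
  by (rule digraph_iso_commuting_clique [OF _ _ assms(2)])
    (use assms(1) in \<open>auto simp: pverts_target_graph card_image inj_on_def\<close>)

lemma digraph_iso_K4:
  assumes "i < 4" "\<Gamma> = node_elem ` (\<lambda>j. Inr (Inr (i, j))) ` {..<4}"
  shows "digraph_iso (with_proj (commuting_graph BT24 \<Gamma>)) (with_proj (complete_graph 4))"
  by (rule digraph_iso_commuting_clique [OF _ _ assms(2)])
    (use assms(1) in \<open>auto simp: pverts_target_graph card_image inj_on_def\<close>)

theorem proposition4p2:
  fixes \<Gamma> :: "bt_letter word set set"
    and G :: "bt_letter word set pair_pre_digraph"
  assumes "G = commuting_graph BT24 \<Gamma>"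
  shows "(\<Gamma> \<in> {BT_B1, BT_B2, BT_B3, BT_B4} \<longrightarrow>
            digraph_iso (with_proj G) (with_proj (complete_graph 2))) \<and>
         (\<Gamma> \<in> {BT_C1, BT_C2, BT_C3, BT_C4} \<longrightarrow>
            digraph_iso (with_proj G) (with_proj (complete_graph 4))) \<and>
         (\<Gamma> = carrier BT24 \<longrightarrow>
            digraph_iso (with_proj G)
              (with_proj
                (graph_join (complete_graph 2)
                  (graph_disj_union
                    (graph_copies 3 (complete_graph 2))
                    (graph_copies 4 (complete_graph 4))))))"
proof (intro conjI impI)
  \<comment> \<open>\<open>BT_B1\<close> is defined as the centre, so its two elements come from
    \<open>group_center_BT24\<close>.\<close>
  have "digraph_iso (with_proj (commuting_graph BT24 BT_B1)) (with_proj (complete_graph 2))"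
    unfolding BT_B1_def
    by (rule digraph_iso_commuting_clique [OF _ _ group_center_BT24])
      (auto simp: pverts_target_graph)
  moreover have "digraph_iso (with_proj (commuting_graph BT24 BT_B2)) (with_proj (complete_graph 2))"
    by (rule digraph_iso_K2 [of 0]) (simp_all add: BT_B2_def lessThan_numerals)
  moreover have "digraph_iso (with_proj (commuting_graph BT24 BT_B3)) (with_proj (complete_graph 2))"
    by (rule digraph_iso_K2 [of 1]) (simp_all add: BT_B3_def lessThan_numerals)
  moreover have "digraph_iso (with_proj (commuting_graph BT24 BT_B4)) (with_proj (complete_graph 2))"
    by (rule digraph_iso_K2 [of 2]) (simp_all add: BT_B4_def lessThan_numerals)
  moreover assume "\<Gamma> \<in> {BT_B1, BT_B2, BT_B3, BT_B4}"
  ultimately show "digraph_iso (with_proj G) (with_proj (complete_graph 2))"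
    using assms by blast
next
  have "digraph_iso (with_proj (commuting_graph BT24 BT_C1)) (with_proj (complete_graph 4))"
    by (rule digraph_iso_K4 [of 0]) (simp_all add: BT_C1_def lessThan_numerals)
  moreover have "digraph_iso (with_proj (commuting_graph BT24 BT_C2)) (with_proj (complete_graph 4))"
    by (rule digraph_iso_K4 [of 1]) (simp_all add: BT_C2_def lessThan_numerals)
  moreover have "digraph_iso (with_proj (commuting_graph BT24 BT_C3)) (with_proj (complete_graph 4))"
    by (rule digraph_iso_K4 [of 2]) (simp_all add: BT_C3_def lessThan_numerals)
  moreover have "digraph_iso (with_proj (commuting_graph BT24 BT_C4)) (with_proj (complete_graph 4))"
    by (rule digraph_iso_K4 [of 3]) (simp_all add: BT_C4_def lessThan_numerals)
  moreover assume "\<Gamma> \<in> {BT_C1, BT_C2, BT_C3, BT_C4}"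
  ultimately show "digraph_iso (with_proj G) (with_proj (complete_graph 4))"
    using assms by blast
next
  assume "\<Gamma> = carrier BT24"
  then show "digraph_iso (with_proj G)
      (with_proj (graph_join (complete_graph 2)
        (graph_disj_union (graph_copies 3 (complete_graph 2)) (graph_copies 4 (complete_graph 4)))))"
    \<comment> \<open>The labelling \<open>node_elem\<close> itself induces the isomorphism. Its
      table stays folded so that \<open>node_elem_commute_iff\<close> can apply.\<close>
    unfolding assms target_graph_def [symmetric]
    by (intro digraph_iso_commuting_graph [of node_elem])
      (simp_all add: bij_betw_node_elem parcs_target_graph node_elem_commute_iff
        cong: conj_cong del: node_elem.simps)
qed

end
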